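(* Let $d\ge 1$ be an integer and let $f_1,\dots,f_d:\mathbb Z\to\mathbb C^*$ be additive characters (group homomorphisms) with $\prod_{k=i}^d|f_k(1)|\le 1$ for all $1\le i\le d$. Then the multiple additive Lucas $L$-function $\mathcal L_U^d(\mathbf s\mid\mathbf f)$ of depth $d$ can be continued to a meromorphic function on all of $\mathbb C^d$, with possible poles on the hyperplanes $$s_j+\cdots+s_d=-2(k_j+\cdots+k_d)+\frac{\log(f_j(1)\cdots f_d(1))}{\log\alpha}+(k_j+\cdots+k_d)\frac{\log|Q|}{\log\alpha}+\left(2n+\ell_{Q,k_j,\dots,k_d}\right)\frac{\pi i}{\log\alpha}$$ for $1\le j\le d$, where $n\in\mathbb Z$ and $k_j,\dots,k_d$ are non-negative integers.
   Context: Standing assumptions: $P,Q$ are real numbers with $P>0$, $Q\ne 0$, $D:=P^2-4Q$, and $Q<P-1$ if $0<P\le 2$, $Q\le P-1$ if $P>2$. Let $\alpha,\beta$ be the roots of $x^2-Px+Q=0$, with $\alpha=(P+\sqrt D)/2$, $\beta=(P-\sqrt D)/2$, and let $U_n=(\alpha^n-\beta^n)/(\alpha-\beta)$ for $n\ge 0$ (Lucas sequence of the first kind). Complex powers of positive reals are taken with the real logarithm; $\log(f_j(1)\cdots f_d(1))$ is any fixed value of the complex logarithm (the choice only shifts $n$). For group homomorphisms $f_1,\dots,f_d:\mathbb Z\to\mathbb C^*$, the multiple Lucas additive $L$-function of depth $d$ is $$\mathcal L_U^d(\mathbf s\mid\mathbf f)=\mathcal L_U^d(s_1,\dots,s_d\mid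 f_1,\dots,f_d):=\sum_{0<n_1<n_2<\cdots<n_d}\frac{f_1(n_1)}{U_{n_1}^{s_1}}\cdots\frac{f_d(n_d)}{U_{n_d}^{s_d}},\qquad f_i(n)=f_i(1)^n,$$ initially defined for $(s_1,\dots,s_d)\in\mathfrak D_d:=\{(s_1,\dots,s_d)\in\mathbb C^d:\ \sum_{i=j}^d\mathrm{Re}(s_i)>0,\ 1\le j\le d\}$, where it converges absolutely under the stated hypothesis on the $f_i$. $\ell_{Q,k_j,\dots,k_d}:=0$ if $Q>0$ and $\ell_{Q,k_j,\dots,k_d}:=k_j+\cdots+k_d$ if $Q<0$. *)

theory Defs
  imports "HOL-Analysis.Analysis"
begin

text \<open>
  Depth $d$ is the cardinality of a finite linearly ordered index type \<open>'n\<close>, which plays the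
  role of $\{1 < \dots < d\}$; so \<open>{j..}\<close> is $\{j,\dots,d\}$, and \<open>complex ^ 'n\<close> is
  $\mathbf{C}^d$.
\<close>

text \<open>
  \<open>has_derivative\<close> on \<open>complex ^ 'n\<close> is real Frechet differentiability; homogeneity
  with respect to \<open>*s\<close> makes the derivative complex linear.
\<close>

definition mv_holomorphic_on :: "(complex ^ 'n \<Rightarrow> complex) \<Rightarrow> (complex ^ 'n) set \<Rightarrow> bool" where
  "mv_holomorphic_on f S \<longleftrightarrow> open S \<and>
     (\<forall>z\<in>S. \<exists>f'. (f has_derivative f') (at z) \<and> (\<forall>c v. f' (c *s v) = c * f' v))"

text \<open>
  A meromorphic function is locally a quotient $g/h$ of holomorphic functions with $h \not\equiv 0$.
  It is represented by a total function whose values at zeros of the denominator are irrelevant.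
\<close>

definition mv_meromorphic_on :: "(complex ^ 'n \<Rightarrow> complex) \<Rightarrow> (complex ^ 'n) set \<Rightarrow> bool" where
  "mv_meromorphic_on f S \<longleftrightarrow>
     (\<forall>p\<in>S. \<exists>W g h. open W \<and> connected W \<and> p \<in> W \<and> W \<subseteq> S \<and>
        mv_holomorphic_on g W \<and> mv_holomorphic_on h W \<and> (\<exists>z\<in>W. h z \<noteq> 0) \<and>
        (\<forall>z\<in>W. h z \<noteq> 0 \<longrightarrow> f z = g z / h z))"

text \<open>
  The hypotheses on \<open>P\<close> and \<open>Q\<close> force a positive discriminant, so both roots are real.
\<close>

definition lucas_alpha :: "real \<Rightarrow> real \<Rightarrow> real" where
  "lucas_alpha P Q = (P + sqrt (P\<^sup>2 - 4 * Q)) / 2"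

definition lucas_beta :: "real \<Rightarrow> real \<Rightarrow> real" where
  "lucas_beta P Q = (P - sqrt (P\<^sup>2 - 4 * Q)) / 2"

definition lucas_U :: "real \<Rightarrow> real \<Rightarrow> nat \<Rightarrow> real" where
  "lucas_U P Q n =
     (lucas_alpha P Q ^ n - lucas_beta P Q ^ n) / (lucas_alpha P Q - lucas_beta P Q)"

definition additive_character :: "(int \<Rightarrow> complex) \<Rightarrow> bool" where
  "additive_character h \<longleftrightarrow> (\<forall>a. h a \<noteq> 0) \<and> (\<forall>a b. h (a + b) = h a * h b)"

definition lucas_L_indices :: "('n :: {finite, linorder} \<Rightarrow> nat) set" where
  "lucas_L_indices = {n. (\<forall>i. 0 < n i) \<and> strict_mono n}"

text \<open>Since \<open>lucas_U P Q m > 0\<close> for \<open>m > 0\<close> under the hypotheses on \<open>P\<close> and \<open>Q\<close>, the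
  principal \<open>powr\<close> below is the power formed with the real logarithm.\<close>

definition lucas_L_term ::
  "real \<Rightarrow> real \<Rightarrow> ('n \<Rightarrow> int \<Rightarrow> complex) \<Rightarrow> complex ^ ('n :: {finite, linorder}) \<Rightarrow>
     ('n \<Rightarrow> nat) \<Rightarrow> complex"
  where
  "lucas_L_term P Q f s n =
     (\<Prod>i\<in>UNIV. f i (int (n i)) / complex_of_real (lucas_U P Q (n i)) powr (s $ i))"

definition lucas_L ::
  "real \<Rightarrow> real \<Rightarrow> ('n \<Rightarrow> int \<Rightarrow> complex) \<Rightarrow> complex ^ ('n :: {finite, linorder}) \<Rightarrow> complex" where
  "lucas_L P Q f s = (\<Sum>\<^sub>\<infinity>n\<in>lucas_L_indices. lucas_L_term P Q f s n)"

definition lucas_L_domain :: "(complex ^ ('n :: {finite, linorder})) set" where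
  "lucas_L_domain = {s. \<forall>j. (\<Sum>i\<in>{j..}. Re (s $ i)) > 0}"

definition lucas_ell :: "real \<Rightarrow> nat \<Rightarrow> nat" where
  "lucas_ell Q K = (if Q < 0 then K else 0)"

text \<open>\<open>c\<close> is a value of $\log(f_j(1)\cdots f_d(1))$.\<close>

definition lucas_L_hyperplane ::
  "real \<Rightarrow> real \<Rightarrow> complex \<Rightarrow> 'n \<Rightarrow> ('n \<Rightarrow> nat) \<Rightarrow> int \<Rightarrow>
     (complex ^ ('n :: {finite, linorder})) set" where
  "lucas_L_hyperplane P Q c j k n =
     (let K = (\<Sum>i\<in>{j..}. k i); la = complex_of_real (ln (lucas_alpha P Q)) in
      {s. (\<Sum>i\<in>{j..}. s $ i) =
            - 2 * of_nat K + c / la + of_nat K * (complex_of_real (ln \<bar>Q\<bar>) / la)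
            + (2 * of_int n + of_nat (lucas_ell Q K)) * (complex_of_real pi * \<i> / la)})"

end

theory Submission
  imports Defs "HOL-Complex_Analysis.Cauchy_Integral_Formula"
begin

text \<open>
  Put $r = \beta/\alpha = Q/\alpha^2$, so $0 < |r| < 1$ and
  $U_n = \alpha^n (1 - r^n)/(\alpha - \beta)$. Expanding every $(1 - r^{n_i})^{-s_i}$ by the
  binomial series and summing over the gaps $n_i - n_{i-1} \ge 1$ gives
  $$(\alpha-\beta)^{s_1+\cdots+s_d} \sum_{k} \prod_i (-1)^{k_i} \binom{-s_i}{k_i}
    \prod_j \frac{y_j}{1 - y_j}, \qquad
    y_j = f_j(1)\cdots f_d(1)\, \alpha^{-(s_j+\cdots+s_d)}\, r^{k_j+\cdots+k_d}.$$
  The poles are where $y_j = 1$, which is the equation of the hyperplanes. On a ball,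
  $|y_j| \le 1/2$ once $k_j+\cdots+k_d$ is large; after multiplication by the finitely many
  remaining factors $1 - y_j$ the series is dominated by $\prod_i \binom{-R}{k_i} (-1)^{k_i} B |r|^{k_i}$, since
  $|r|^{k_j+\cdots+k_d} \le |r|^{k_j}$, so it is holomorphic by the Weierstrass test.
\<close>

section \<open>Holomorphic functions on $\mathbf{C}^d$\<close>

text \<open>The condition inside \<open>mv_holomorphic_on\<close>, separated from openness so that
  closure rules can be stated at a single point.\<close>

definition mv_differentiable_at :: "(complex ^ 'n \<Rightarrow> complex) \<Rightarrow> complex ^ 'n \<Rightarrow> bool" where
  "mv_differentiable_at f z \<longleftrightarrow>
     (\<exists>f'. (f has_derivative f') (at z) \<and> (\<forall>c v. f' (c *s v) = c * f' v))"

lemma mv_holomorphic_on_iff: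
  "mv_holomorphic_on f S \<longleftrightarrow> open S \<and> (\<forall>z\<in>S. mv_differentiable_at f z)"
  by (simp add: mv_holomorphic_on_def mv_differentiable_at_def)

lemma mv_differentiable_at_cong:
  assumes "mv_differentiable_at f z" and "open S" and "z \<in> S" and "\<And>w. w \<in> S \<Longrightarrow> f w = g w"
  shows "mv_differentiable_at g z"
proof -
  obtain f' where "(f has_derivative f') (at z)" "\<And>c v. f' (c *s v) = c * f' v"
    using assms(1) unfolding mv_differentiable_at_def by blast
  moreover from this(1) have "(g has_derivative f') (at z)"
    by (rule has_derivative_transform_within_open[OF _ assms(2,3)]) (fact assms(4))
  ultimately show ?thesis unfolding mv_differentiable_at_def by blast
qed

lemma mv_differentiable_at_const: "mv_differentiable_at (\<lambda>_. c) z"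
  unfolding mv_differentiable_at_def by (rule exI[of _ "\<lambda>_. 0"]) auto

lemma mv_differentiable_at_mult:
  assumes "mv_differentiable_at f z" and "mv_differentiable_at g z"
  shows "mv_differentiable_at (\<lambda>w. f w * g w) z"
proof -
  obtain f' g' where "(f has_derivative f') (at z)" "\<And>c v. f' (c *s v) = c * f' v"
    "(g has_derivative g') (at z)" "\<And>c v. g' (c *s v) = c * g' v"
    using assms unfolding mv_differentiable_at_def by blast
  then show ?thesis
    unfolding mv_differentiable_at_def
    by (intro exI[of _ "\<lambda>h. f z * g' h + f' h * g z"])
       (auto intro: has_derivative_mult simp: algebra_simps)
qed

lemma mv_differentiable_at_prod:
  assumes "\<And>i. i \<in> I \<Longrightarrow> mv_differentiable_at (f i) z"
  shows "mv_differentiable_at (\<lambda>w. \<Prod>i\<in>I. f i w) z"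
  using assms
  by (induction I rule: infinite_finite_induct)
     (auto simp: mv_differentiable_at_const intro: mv_differentiable_at_mult)

lemma mv_differentiable_at_inverse:
  assumes "mv_differentiable_at f z" and "f z \<noteq> 0"
  shows "mv_differentiable_at (\<lambda>w. inverse (f w)) z"
proof -
  obtain f' where "(f has_derivative f') (at z)" "\<And>c v. f' (c *s v) = c * f' v"
    using assms unfolding mv_differentiable_at_def by blast
  then show ?thesis
    unfolding mv_differentiable_at_def
    by (intro exI[of _ "\<lambda>h. - (inverse (f z) * f' h * inverse (f z))"] conjI
          Deriv.has_derivative_inverse assms(2)) simp_all
qed

lemma mv_differentiable_at_divide:
  assumes "mv_differentiable_at f z" and "mv_differentiable_at g z" and "g z \<noteq> 0"
  shows "mv_differentiable_at (\<lambda>w. f w / g w) z"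
  using mv_differentiable_at_mult[OF assms(1) mv_differentiable_at_inverse[OF assms(2,3)]]
  by (simp add: divide_inverse)

text \<open>Every non-constant building block below depends on the point only through a sum of
  coordinates, so the chain rule for a linear form suffices; a singleton \<open>I\<close> gives one
  coordinate.\<close>

lemma mv_differentiable_at_compose_sum:
  assumes "(\<phi> has_field_derivative D) (at (\<Sum>i\<in>I. z $ i))"
  shows "mv_differentiable_at (\<lambda>w. \<phi> (\<Sum>i\<in>I. w $ i)) z"
proof -
  have "((\<lambda>w. \<Sum>i\<in>I. w $ i) has_derivative (\<lambda>w. \<Sum>i\<in>I. w $ i)) (at z)"
    by (intro bounded_linear_imp_has_derivative bounded_linear_sum bounded_linear_vec_nth)
  moreover have "(\<phi> has_derivative (*) D) (at (\<Sum>i\<in>I. z $ i))"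
    using assms by (simp add: has_field_derivative_def)
  ultimately have "((\<lambda>w. \<phi> (\<Sum>i\<in>I. w $ i)) has_derivative (\<lambda>h. D * (\<Sum>i\<in>I. h $ i))) (at z)"
    by (rule has_derivative_compose)
  then show ?thesis
    unfolding mv_differentiable_at_def
    by (intro exI[of _ "\<lambda>h. D * (\<Sum>i\<in>I. h $ i)"]) (simp add: sum_distrib_left mult_ac)
qed

section \<open>Cauchy estimates and series of holomorphic functions\<close>

lemma norm_vector_scalar_mult: "norm (c *s v) = cmod c * norm v" for v :: "complex ^ 'n"
  by (simp add: norm_vec_def norm_mult L2_set_right_distrib)

text \<open>The directional derivative is the derivative of a function of one complex variable, to
  which Cauchy's estimate applies.\<close>

lemma mv_derivative_bound:
  assumes hol: "mv_holomorphic_on f (ball z \<rho>)" and bd: "\<And>w. w \<in> ball z \<rho> \<Longrightarrow> cmod (f w) \<le> B"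
    and \<delta>: "0 < \<delta>" "\<delta> < \<rho>"
    and f': "(f has_derivative f') (at z)" "\<And>c v. f' (c *s v) = c * f' v"
  shows "cmod (f' v) \<le> B / \<delta> * norm v"
proof (cases "v = 0")
  case True
  then show ?thesis using f'(2)[of 0 0] by simp
next
  case False
  define u where "u = complex_of_real (1 / norm v) *s v"
  have nu: "norm u = 1" using False by (simp add: u_def norm_vector_scalar_mult norm_divide)
  have vu: "v = complex_of_real (norm v) *s u"
    using False by (simp add: u_def vector_smult_assoc)
  have der: "\<exists>D. ((\<lambda>t. f (z + t *s u)) has_field_derivative D) (at t) \<and> (t = 0 \<longrightarrow> D = f' u)"
    if t: "cmod t < \<rho>" for t
  proof -
    have "z + t *s u \<in> ball z \<rho>"
      using t by (simp add: dist_norm norm_vector_scalar_mult nu)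
    \<comment> \<open>At \<open>t = 0\<close> the given \<open>f'\<close> itself is taken as the
      derivative, so that Cauchy's estimate at the centre bounds exactly
      \<open>f' u\<close>.\<close>
    then obtain g' where g': "(f has_derivative g') (at (z + t *s u))" "\<And>c v. g' (c *s v) = c * g' v"
      and eq: "t = 0 \<Longrightarrow> g' = f'"
    proof (cases "t = 0")
      case True
      then show ?thesis using f' that[of f'] by (simp add: f')
    next
      case False
      then show ?thesis using that hol \<open>z + t *s u \<in> ball z \<rho>\<close> unfolding mv_holomorphic_on_def by blast
    qed
    have "bounded_linear (\<lambda>t. t *s u)"
      by (rule bounded_linear_intro[of _ "norm u"])
         (auto simp: vec_eq_iff algebra_simps norm_vector_scalar_mult scaleR_conv_of_real[where 'a=complex])
    then have "((\<lambda>t. z + t *s u) has_derivative (\<lambda>t. t *s u)) (at t)"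
      by (auto intro!: derivative_eq_intros bounded_linear_imp_has_derivative)
    from has_derivative_compose[OF this g'(1)]
    have "((\<lambda>t. f (z + t *s u)) has_field_derivative g' u) (at t)"
      unfolding has_field_derivative_def g'(2) by (simp add: mult.commute[of _ "g' u"])
    then show ?thesis using eq by blast
  qed
  have hol1: "(\<lambda>t. f (z + t *s u)) holomorphic_on ball 0 \<rho>"
    unfolding holomorphic_on_def field_differentiable_def
    using der has_field_derivative_at_within by (metis mem_ball_0)
  have "cmod ((deriv ^^ 1) (\<lambda>t. f (z + t *s u)) 0) \<le> fact 1 * B / \<delta> ^ 1"
  proof (rule Cauchy_inequality)
    show "(\<lambda>t. f (z + t *s u)) holomorphic_on ball 0 \<delta>"
      by (rule holomorphic_on_subset[OF hol1]) (use \<delta> in auto)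
    show "continuous_on (cball 0 \<delta>) (\<lambda>t. f (z + t *s u))"
      by (rule continuous_on_subset[OF holomorphic_on_imp_continuous_on[OF hol1]]) (use \<delta> in auto)
    show "cmod (f (z + x *s u)) \<le> B" if "cmod (0 - x) = \<delta>" for x
      by (rule bd) (use that \<delta> in \<open>simp add: dist_norm norm_vector_scalar_mult nu\<close>)
  qed (use \<delta> in auto)
  moreover have "deriv (\<lambda>t. f (z + t *s u)) 0 = f' u"
    using der[of 0] \<delta> by (auto intro: DERIV_imp_deriv)
  ultimately have "cmod (f' u) \<le> B / \<delta>" by simp
  moreover have "cmod (f' v) = norm v * cmod (f' u)"
    by (subst vu) (simp add: f'(2) norm_mult)
  ultimately show ?thesis
    by (metis mult.commute mult_right_mono norm_ge_zero)
qed

text \<open>Weierstrass test: on a smaller ball Cauchy's estimate turns the majorant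
  \<open>M k\<close> of the terms into the majorant \<open>M k / \<delta>\<close> of their
  derivatives, so the series may be differentiated term by term. Complex homogeneity passes to the
  sum of the derivatives.\<close>

lemma mv_holomorphic_on_suminf:
  fixes f :: "nat \<Rightarrow> complex ^ 'n \<Rightarrow> complex"
  assumes hol: "\<And>k. mv_holomorphic_on (f k) (ball p \<rho>)"
    and bd: "\<And>k w. w \<in> ball p \<rho> \<Longrightarrow> cmod (f k w) \<le> M k"
    and M: "summable M"
  shows "mv_holomorphic_on (\<lambda>w. \<Sum>k. f k w) (ball p \<rho>)"
  unfolding mv_holomorphic_on_iff
proof (intro conjI ballI)
  fix z assume z: "z \<in> ball p \<rho>"
  obtain e where e: "e > 0" "ball z e \<subseteq> ball p \<rho>"
    using z open_ball open_contains_ball by meson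
  \<comment> \<open>A third of \<open>e\<close>: balls of radius \<open>2 * \<delta>\<close> about
    points of \<open>ball z \<delta>\<close> stay inside \<open>ball z e\<close>, so one estimate
    serves all of \<open>S\<close>.\<close>
  define \<delta> where "\<delta> = e / 3"
  define S where "S = ball z \<delta>"
  have sub: "ball x (2 * \<delta>) \<subseteq> ball p \<rho>" if "x \<in> S" for x
  proof -
    have "ball x (2 * \<delta>) \<subseteq> ball z e"
    proof
      fix y assume "y \<in> ball x (2 * \<delta>)"
      then show "y \<in> ball z e"
        using that dist_triangle[of z y x] by (simp add: S_def \<delta>_def)
    qed
    then show ?thesis using e by blast
  qed
  have \<delta>: "\<delta> > 0" using e by (simp add: \<delta>_def)
  have in_ball: "x \<in> ball p \<rho>" if "x \<in> S" for x using sub[OF that] \<delta> centre_in_ball[of x "2 * \<delta>"] by fastforce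
  have M0: "0 \<le> M k" for k using bd[OF z, of k] norm_ge_zero order_trans by blast
  have "\<forall>k x. \<exists>f'. x \<in> S \<longrightarrow>
      (f k has_derivative f') (at x) \<and> (\<forall>c v. f' (c *s v) = c * f' v)"
    using hol in_ball unfolding mv_holomorphic_on_def by blast
  then obtain f' where f': "\<And>k x. x \<in> S \<Longrightarrow>
      (f k has_derivative f' k x) (at x) \<and> (\<forall>c v. f' k x (c *s v) = c * f' k x v)"
    by metis
  have f'_bd: "cmod (f' k x v) \<le> M k / \<delta> * norm v" if "x \<in> S" for k x v
  proof (rule mv_derivative_bound)
    show "mv_holomorphic_on (f k) (ball x (2 * \<delta>))"
      using hol sub[OF that] unfolding mv_holomorphic_on_iff by blast
    show "cmod (f k w) \<le> M k" if "w \<in> ball x (2 * \<delta>)" for w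
      using bd sub[OF \<open>x \<in> S\<close>] that by blast
  qed (use \<delta> f'[OF that] in auto)
  have M\<delta>: "summable (\<lambda>k. M k / \<delta> * c)" for c
    by (intro summable_mult2 summable_divide M)
  have sum_f': "summable (\<lambda>k. cmod (f' k x v))" if "x \<in> S" for x v
    by (rule summable_comparison_test'[OF M\<delta>[of "norm v"]])
       (use f'_bd[OF that] in \<open>simp only: real_norm_def abs_norm_cancel\<close>)
  define g' where "g' x v = (\<Sum>k. f' k x v)" for x v
  have sum_f: "summable (\<lambda>k. f k x)" if "x \<in> S" for x
    by (rule summable_comparison_test_ev[OF _ M]) (simp add: bd[OF in_ball[OF that]])
  \<comment> \<open>Uniform convergence of the derived series as linear maps: the tail of the sum of
    \<open>M k / \<delta>\<close> depends on neither \<open>x\<close> nor \<open>h\<close>.\<close>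
  have tail: "\<forall>\<^sub>F n in sequentially. \<forall>x\<in>S. \<forall>h. norm (sum (\<lambda>i. f' i x h) {..<n} - g' x h) \<le> \<epsilon> * norm h"
    if \<epsilon>: "\<epsilon> > 0" for \<epsilon>
  proof -
    have "eventually (\<lambda>n. norm (\<Sum>i. M (i + n) / \<delta>) < \<epsilon>) sequentially"
      using suminf_exist_split[OF \<epsilon>, of "\<lambda>k. M k / \<delta>"] M\<delta>[of 1]
      by (auto simp: eventually_sequentially)
    then show ?thesis
    proof (rule eventually_mono, intro ballI allI)
      fix n x h assume n: "norm (\<Sum>i. M (i + n) / \<delta>) < \<epsilon>" and x: "x \<in> S"
      have "g' x h = (\<Sum>i. f' (i + n) x h) + sum (\<lambda>i. f' i x h) {..<n}"
        unfolding g'_def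
        by (rule suminf_split_initial_segment[OF summable_norm_cancel[OF sum_f'[OF x]]])
      then have "norm (sum (\<lambda>i. f' i x h) {..<n} - g' x h) = norm (\<Sum>i. f' (i + n) x h)"
        by simp
      also have "\<dots> \<le> (\<Sum>i. M (i + n) / \<delta> * norm h)"
        by (rule norm_suminf_le[OF f'_bd[OF x] summable_ignore_initial_segment[OF M\<delta>]])
      also have "\<dots> = (\<Sum>i. M (i + n) / \<delta>) * norm h"
        by (rule suminf_mult2[symmetric]) (use summable_ignore_initial_segment[OF M\<delta>[of 1]] in simp)
      also have "\<dots> \<le> \<epsilon> * norm h"
        using n by (intro mult_right_mono) auto
      finally show "norm (sum (\<lambda>i. f' i x h) {..<n} - g' x h) \<le> \<epsilon> * norm h" .
    qed
  qed
  have zS: "z \<in> S" using \<delta> by (simp add: S_def)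
  have "\<exists>g. \<forall>x\<in>S. (\<lambda>n. f n x) sums g x \<and> (g has_derivative g' x) (at x within S)"
  proof (rule has_derivative_series)
    show "convex S" by (simp add: S_def)
    show "(f n has_derivative f' n x) (at x within S)" if "x \<in> S" for n x
      using f'[OF that] has_derivative_at_withinI by blast
    show "(\<lambda>n. f n z) sums (\<Sum>n. f n z)" using sum_f[OF zS] by (rule summable_sums)
  qed (use tail zS in auto)
  then obtain g where g: "\<And>x. x \<in> S \<Longrightarrow> (\<lambda>n. f n x) sums g x"
    "\<And>x. x \<in> S \<Longrightarrow> (g has_derivative g' x) (at x within S)" by blast
  have "(g has_derivative g' z) (at z)"
    using g(2)[OF zS] zS at_within_open[of z S] by (simp add: S_def)
  moreover have "g' z (c *s v) = c * g' z v" for c v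
    unfolding g'_def using f'[OF zS] suminf_mult[OF summable_norm_cancel[OF sum_f'[OF zS]]] by simp
  ultimately have "mv_differentiable_at g z"
    unfolding mv_differentiable_at_def by blast
  then show "mv_differentiable_at (\<lambda>w. \<Sum>k. f k w) z"
    by (rule mv_differentiable_at_cong[of _ _ S]) (use zS g(1) in \<open>auto simp: S_def sums_iff\<close>)
qed simp

text \<open>An infinite countable index type is enumerated by the naturals, and absolute convergence
  makes the unordered sum equal to the series.\<close>

lemma mv_holomorphic_on_infsum:
  fixes f :: "'k :: countable \<Rightarrow> complex ^ 'n \<Rightarrow> complex"
  assumes inf: "infinite (UNIV :: 'k set)"
    and hol: "\<And>k. mv_holomorphic_on (f k) (ball p \<rho>)"
    and bd: "\<And>k w. w \<in> ball p \<rho> \<Longrightarrow> cmod (f k w) \<le> M k"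
    and M: "M summable_on UNIV"
  shows "mv_holomorphic_on (\<lambda>w. \<Sum>\<^sub>\<infinity>k. f k w) (ball p \<rho>)"
proof -
  define e :: "nat \<Rightarrow> 'k" where "e = from_nat_into UNIV"
  have bij: "bij_betw e UNIV UNIV"
    unfolding e_def by (intro bij_betw_from_nat_into inf) auto
  have M': "summable (\<lambda>n. M (e n))"
    using M summable_on_reindex_bij_betw[OF bij, of M] by (simp add: summable_on_imp_summable)
  have hol_e: "mv_holomorphic_on (\<lambda>w. \<Sum>n. f (e n) w) (ball p \<rho>)"
    by (rule mv_holomorphic_on_suminf[OF hol _ M']) (use bd in auto)
  have eq: "(\<Sum>n. f (e n) w) = (\<Sum>\<^sub>\<infinity>k. f k w)" if "w \<in> ball p \<rho>" for w
  proof -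
    have "summable (\<lambda>n. norm (f (e n) w))"
      by (rule summable_comparison_test_ev[OF _ M']) (simp add: bd[OF that])
    then have "((\<lambda>n. f (e n) w) has_sum (\<Sum>n. f (e n) w)) UNIV"
      by (intro norm_summable_imp_has_sum) (auto intro: summable_sums summable_norm_cancel)
    then show ?thesis
      using infsum_reindex_bij_betw[OF bij, of "\<lambda>k. f k w"] by (simp add: infsumI)
  qed
  show ?thesis
    unfolding mv_holomorphic_on_iff
  proof (intro conjI ballI open_ball)
    fix z assume z: "z \<in> ball p \<rho>"
    then have "mv_differentiable_at (\<lambda>w. \<Sum>n. f (e n) w) z"
      using hol_e by (simp add: mv_holomorphic_on_iff)
    then show "mv_differentiable_at (\<lambda>w. \<Sum>\<^sub>\<infinity>k. f k w) z"
      by (rule mv_differentiable_at_cong[OF _ open_ball z eq])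
  qed
qed

section \<open>Sums over increasing multi-indices\<close>

lemma summable_on_prod_funs:
  fixes f :: "'a :: finite \<Rightarrow> nat \<Rightarrow> real"
  assumes "\<And>i. f i summable_on B i" and "\<And>i n. n \<in> B i \<Longrightarrow> 0 \<le> f i n"
  shows "(\<lambda>g. \<Prod>i\<in>UNIV. f i (g i)) summable_on Pi UNIV B"
proof -
  have "(\<lambda>n. norm (f i n)) summable_on B i" for i
    using assms(1)[of i] summable_on_iff_abs_summable_on_real by blast
  then have "(\<lambda>g. norm (\<Prod>i\<in>UNIV. f i (g i))) summable_on PiE UNIV B"
    unfolding abs_summable_equivalent
    by (intro abs_summable_on_prod_PiE) (auto simp: abs_summable_equivalent)
  then show ?thesis
    by (simp add: abs_summable_summable PiE_UNIV_domain)
qed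

lemma infsum_prod_funs:
  fixes f :: "'a :: finite \<Rightarrow> 'b \<Rightarrow> complex"
  assumes "\<And>i. (\<lambda>n. norm (f i n)) summable_on B i"
  shows "(\<Sum>\<^sub>\<infinity>g\<in>Pi UNIV B. \<Prod>i\<in>UNIV. f i (g i)) = (\<Prod>i\<in>UNIV. infsum (f i) (B i))"
  using infsum_prod_PiE_abs[of UNIV f B] assms by (simp add: PiE_UNIV_domain)

section \<open>Increasing multi-indices and their gaps\<close>

definition gap_sums :: "('a :: {finite, linorder} \<Rightarrow> nat) \<Rightarrow> 'a \<Rightarrow> nat" where
  "gap_sums m i = (\<Sum>l\<in>{..i}. m l)"

text \<open>Inserting 0 gives the least index the previous value 0, so that its gap is the entry
  itself.\<close>

definition prev_value :: "('a :: {finite, linorder} \<Rightarrow> nat) \<Rightarrow> 'a \<Rightarrow> nat" where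
  "prev_value n i = Max (insert 0 (n ` {..<i}))"

text \<open>Supplies immediate predecessors in the abstract index type, in place of the step from i
  to i - 1.\<close>

lemma finite_linorder_pred_cases:
  fixes i :: "'a :: {finite, linorder}"
  obtains "{..<i} = {}" | p where "p < i" and "{..<i} = {..p}"
proof (cases "{..<i} = {}")
  case False
  then have "Max {..<i} < i" using Max_in[of "{..<i}"] by auto
  moreover have "{..<i} = {..Max {..<i}}"
    using \<open>Max {..<i} < i\<close> by (auto intro: Max_ge[OF finite])
  ultimately show ?thesis using that by blast
qed

lemma atMost_eq_insert: "{..i} = insert i {..<i}" for i :: "'a :: order"
  by auto

lemma gap_sums_eq: "gap_sums m i = (\<Sum>l\<in>{..<i}. m l) + m i"
  by (simp add: gap_sums_def atMost_eq_insert)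

lemma prev_value_atMost: "mono n \<Longrightarrow> {..<i} = {..p} \<Longrightarrow> prev_value n i = n p"
  unfolding prev_value_def by (rule Max_eqI) (auto dest: monoD)

lemma prev_value_gap_sums: "prev_value (gap_sums m) i = (\<Sum>l\<in>{..<i}. m l)"
proof -
  have "mono (gap_sums m)"
    by (intro monoI) (auto simp: gap_sums_def intro: sum_mono2)
  show ?thesis
  proof (cases i rule: finite_linorder_pred_cases)
    case 1
    then show ?thesis by (simp add: prev_value_def)
  next
    case (2 p)
    then show ?thesis
      using prev_value_atMost[OF \<open>mono (gap_sums m)\<close> 2(2)] by (simp add: gap_sums_def)
  qed
qed

lemma prev_value_less:
  assumes "n \<in> lucas_L_indices"
  shows "prev_value n i < n i"
  using assms unfolding prev_value_def lucas_L_indices_def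
  by (subst Max_less_iff) (auto dest: strict_monoD)

text \<open>The gaps telescope. The induction runs on the number of smaller indices and uses the
  hypothesis at the immediate predecessor.\<close>

lemma gap_sums_prev_value:
  assumes "n \<in> lucas_L_indices"
  shows "gap_sums (\<lambda>i. n i - prev_value n i) i = n i"
proof (induction "card {..<i}" arbitrary: i rule: less_induct)
  case less
  have "(\<Sum>l\<in>{..<i}. n l - prev_value n l) = prev_value n i"
  proof (cases i rule: finite_linorder_pred_cases)
    case 1
    then show ?thesis by (simp add: prev_value_def)
  next
    case (2 p)
    have "mono n" using assms by (simp add: lucas_L_indices_def strict_mono_mono)
    have "{..<p} \<subset> {..<i}" using 2(1) by auto
    then have "card {..<p} < card {..<i}" by (simp add: psubset_card_mono)
    from less.hyps[OF this] have "gap_sums (\<lambda>i. n i - prev_value n i) p = n p" .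
    also have "n p = prev_value n i"
      using prev_value_atMost[OF \<open>mono n\<close> 2(2)] by simp
    finally show ?thesis unfolding gap_sums_def 2(2) .
  qed
  then show ?case
    using prev_value_less[OF assms, of i] by (simp add: gap_sums_eq)
qed

text \<open>Replaces the ordering constraint by independent positive gaps, so that sums over
  multi-indices factor.\<close>

lemma bij_betw_gap_sums:
  "bij_betw gap_sums (Pi UNIV (\<lambda>_. {1..}) :: ('a :: {finite, linorder} \<Rightarrow> nat) set) lucas_L_indices"
  (is "bij_betw _ ?A ?B")
proof (rule bij_betw_byWitness[where f' = "\<lambda>n i. n i - prev_value n i"])
  show "\<forall>m\<in>?A. (\<lambda>i. gap_sums m i - prev_value (gap_sums m) i) = m"
    by (simp add: prev_value_gap_sums gap_sums_eq)
  show "\<forall>n\<in>?B. gap_sums (\<lambda>i. n i - prev_value n i) = n"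
    by (intro ballI ext gap_sums_prev_value)
  show "gap_sums ` ?A \<subseteq> ?B"
  proof (rule image_subsetI)
    fix m :: "'a \<Rightarrow> nat" assume m: "m \<in> UNIV \<rightarrow> {1..}"
    have pos: "0 < m i" for i using m by (auto simp: Pi_iff Suc_le_eq)
    have "gap_sums m i < gap_sums m j" if "i < j" for i j
    proof -
      have "gap_sums m i \<le> (\<Sum>l\<in>{..<j}. m l)"
        unfolding gap_sums_def using that by (intro sum_mono2) auto
      then show ?thesis using pos[of j] by (simp add: gap_sums_eq)
    qed
    moreover have "0 < gap_sums m i" for i using pos[of i] by (simp add: gap_sums_eq)
    ultimately show "gap_sums m \<in> lucas_L_indices"
      by (simp add: strict_mono_def lucas_L_indices_def)
  qed
  show "(\<lambda>n i. n i - prev_value n i) ` ?B \<subseteq> ?A"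
    by (auto simp: Suc_le_eq prev_value_less)
qed

text \<open>The gap \<open>m l\<close> enters the exponent of \<open>x i\<close> for every i >= l;
  exchanging the two products collects these factors into a tail product.\<close>

lemma prod_power_gap_sums:
  fixes x :: "'a :: {finite, linorder} \<Rightarrow> 'b :: comm_semiring_1"
  shows "(\<Prod>i\<in>UNIV. x i ^ gap_sums m i) = (\<Prod>l\<in>UNIV. (\<Prod>i\<in>{l..}. x i) ^ m l)"
proof -
  have "(\<Prod>i\<in>UNIV. x i ^ gap_sums m i) = (\<Prod>i\<in>UNIV. \<Prod>l | l \<in> UNIV \<and> l \<le> i. x i ^ m l)"
    by (simp add: gap_sums_def power_sum atMost_def)
  also have "\<dots> = (\<Prod>l\<in>UNIV. \<Prod>i | i \<in> UNIV \<and> l \<le> i. x i ^ m l)"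
    by (rule prod.swap_restrict) auto
  finally show ?thesis by (simp add: prod_power_distrib[symmetric] atLeast_def)
qed

text \<open>In terms of the gaps the sum is a product of independent geometric series. They start at
  exponent 1, hence y / (1 - y) and not 1 / (1 - y).\<close>

lemma sum_prod_powers_indices:
  fixes x :: "'n :: {finite, linorder} \<Rightarrow> complex"
  assumes "\<And>j. cmod (\<Prod>i\<in>{j..}. x i) < 1"
  shows "(\<lambda>n. cmod (\<Prod>i\<in>UNIV. x i ^ n i)) summable_on lucas_L_indices"
    and "(\<Sum>\<^sub>\<infinity>n\<in>lucas_L_indices. \<Prod>i\<in>UNIV. x i ^ n i) =
      (\<Prod>j\<in>UNIV. (\<Prod>i\<in>{j..}. x i) / (1 - (\<Prod>i\<in>{j..}. x i)))"
proof -
  define y where "y j = (\<Prod>i\<in>{j..}. x i)" for j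
  have y: "(\<lambda>m. cmod (y j ^ m)) summable_on {1..}" "((\<lambda>m. y j ^ m) has_sum (y j / (1 - y j))) {1..}" for j
    using has_sum_imp_summable[OF has_sum_geometric_from_1[of "cmod (y j)"]]
      has_sum_geometric_from_1[of "y j"] assms[of j]
    by (simp_all add: y_def norm_power)
  have "(\<lambda>m. \<Prod>j\<in>UNIV. cmod (y j ^ m j)) summable_on Pi UNIV (\<lambda>_. {1..})"
    by (rule summable_on_prod_funs) (use y in auto)
  then show "(\<lambda>n. cmod (\<Prod>i\<in>UNIV. x i ^ n i)) summable_on lucas_L_indices"
    using summable_on_reindex_bij_betw[OF bij_betw_gap_sums, of "\<lambda>n. cmod (\<Prod>i\<in>UNIV. x i ^ n i)"]
    by (simp add: prod_power_gap_sums y_def[symmetric] prod_norm[symmetric])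
  have "(\<Sum>\<^sub>\<infinity>m\<in>Pi UNIV (\<lambda>_. {1..}). \<Prod>j\<in>UNIV. y j ^ m j) = (\<Prod>j\<in>UNIV. infsum (\<lambda>m. y j ^ m) {1..})"
    by (rule infsum_prod_funs) (use y in auto)
  also have "\<dots> = (\<Prod>j\<in>UNIV. y j / (1 - y j))"
    using y by (intro prod.cong infsumI) auto
  finally show "(\<Sum>\<^sub>\<infinity>n\<in>lucas_L_indices. \<Prod>i\<in>UNIV. x i ^ n i) =
      (\<Prod>j\<in>UNIV. (\<Prod>i\<in>{j..}. x i) / (1 - (\<Prod>i\<in>{j..}. x i)))"
    using infsum_reindex_bij_betw[OF bij_betw_gap_sums, of "\<lambda>n. \<Prod>i\<in>UNIV. x i ^ n i"]
    by (simp add: prod_power_gap_sums y_def[symmetric])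
qed

text \<open>This is the binomial series of (1 - \<rho>)^(-R), whose terms are nonnegative.\<close>

lemma summable_pochhammer_powers:
  fixes R \<rho> :: real
  assumes "0 \<le> R" "0 \<le> \<rho>" "\<rho> < 1"
  shows "(\<lambda>k. pochhammer R k / fact k * \<rho> ^ k) summable_on UNIV"
proof -
  have "(\<lambda>k. (-R gchoose k) * (-\<rho>) ^ k) sums (1 + -\<rho>) powr -R"
    by (rule gen_binomial_real) (use assms in auto)
  moreover have "(-R gchoose k) * (-\<rho>) ^ k = pochhammer R k / fact k * \<rho> ^ k" for k
    by (simp add: gbinomial_pochhammer power_minus[of \<rho>])
  ultimately have "summable (\<lambda>k. pochhammer R k / fact k * \<rho> ^ k)"
    by (simp add: sums_iff)
  then show ?thesis
    using assms by (intro summable_nonneg_imp_summable_on) (auto simp: pochhammer_prod intro!: mult_nonneg_nonneg divide_nonneg_nonneg prod_nonneg)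
qed

text \<open>Each numerator factor satisfies |a - i| <= R + i, and these bounds multiply to the
  rising factorial.\<close>

lemma norm_gbinomial_le:
  fixes a :: complex
  assumes "cmod a \<le> R"
  shows "cmod (a gchoose k) \<le> pochhammer R k / fact k"
proof -
  have le: "cmod (a - of_nat i) \<le> R + of_nat i" for i
    using norm_triangle_ineq4[of a "of_nat i"] assms by simp
  have "cmod (a gchoose k) = (\<Prod>i=0..<k. cmod (a - of_nat i)) / fact k"
    unfolding gbinomial_prod_rev norm_divide prod_norm by simp
  also have "\<dots> \<le> (\<Prod>i=0..<k. R + of_nat i) / fact k"
    by (intro divide_right_mono prod_mono) (simp_all add: le)
  finally show ?thesis by (simp only: pochhammer_prod)
qed

section \<open>The continued series\<close>

text \<open>This is y_j for k = 0: with \<open>la\<close> = ln \<alpha>, it is f_j(1)...f_d(1)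
  \<alpha>^(-(s_j+...+s_d)), written through the chosen logarithm \<open>lg j\<close>.\<close>

definition pole_factor :: "real \<Rightarrow> ('n \<Rightarrow> complex) \<Rightarrow> 'n \<Rightarrow> complex ^ ('n :: {finite, linorder}) \<Rightarrow> complex" where
  "pole_factor la lg j s = exp (lg j - of_real la * (\<Sum>i\<in>{j..}. s $ i))"

text \<open>The coefficient of the product of the (r^(n_i))^(k_i) in the expansion of the product of
  the (1 - r^(n_i))^(-s_i).\<close>

definition binomial_factor :: "('n \<Rightarrow> nat) \<Rightarrow> complex ^ ('n :: {finite, linorder}) \<Rightarrow> complex" where
  "binomial_factor k s = (\<Prod>i\<in>UNIV. (- (s $ i) gchoose k i) * (-1) ^ k i)"

definition tail_sum :: "('n :: {finite, linorder} \<Rightarrow> nat) \<Rightarrow> 'n \<Rightarrow> nat" where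
  "tail_sum k j = (\<Sum>i\<in>{j..}. k i)"

lemma le_tail_sum: "k j \<le> tail_sum k j"
  unfolding tail_sum_def by (rule member_le_sum) auto

lemma mv_differentiable_pole_factor: "mv_differentiable_at (pole_factor la lg j) z"
  unfolding pole_factor_def
  by (rule mv_differentiable_at_compose_sum[where \<phi> = "\<lambda>t. exp (lg j - of_real la * t)"])
     (auto intro!: derivative_eq_intros)

lemma mv_differentiable_binomial_factor: "mv_differentiable_at (binomial_factor k) z"
  unfolding binomial_factor_def
proof (intro mv_differentiable_at_prod)
  fix i
  have "(\<lambda>t. (- t gchoose k i) * (-1) ^ k i) holomorphic_on UNIV"
    unfolding gbinomial_prod_rev by (intro holomorphic_intros) auto
  then obtain D where "((\<lambda>t. (- t gchoose k i) * (-1) ^ k i) has_field_derivative D) (at (\<Sum>l\<in>{i}. z $ l))"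
    unfolding holomorphic_on_def field_differentiable_def by auto
  from mv_differentiable_at_compose_sum[OF this]
  show "mv_differentiable_at (\<lambda>w. (- (w $ i) gchoose k i) * (-1) ^ k i) z" by simp
qed

text \<open>Isolates the data on which the continued series depends. In the application
  \<open>r\<close> = \<beta>/\<alpha>, \<open>la\<close> = ln \<alpha>, and \<open>A\<close> =
  ln(\<alpha> - \<beta>) accounts for the prefactor.\<close>

locale binomial_continuation =
  fixes r la A :: real and lg :: "'n :: {finite, linorder} \<Rightarrow> complex"
  assumes r: "\<bar>r\<bar> < 1" "r \<noteq> 0" and la: "0 < la"
begin

text \<open>The quantity y_j. It depends on k only through K = k_j + ... + k_d, so for each j a
  single natural number indexes the possible poles.\<close>

definition pole_term :: "'n \<Rightarrow> (complex, 'n) vec \<Rightarrow> nat \<Rightarrow> complex" where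
  "pole_term j s K = pole_factor la lg j s * of_real r ^ K"

definition summand :: "('n \<Rightarrow> nat) \<Rightarrow> (complex, 'n) vec \<Rightarrow> complex" where
  "summand k s = binomial_factor k s * (\<Prod>j\<in>UNIV. pole_term j s (tail_sum k j) / (1 - pole_term j s (tail_sum k j)))"

definition continuation :: "(complex, 'n) vec \<Rightarrow> complex" where
  "continuation s = exp (of_real A * (\<Sum>i\<in>UNIV. s $ i)) * (\<Sum>\<^sub>\<infinity>k. summand k s)"

definition denominator :: "nat \<Rightarrow> (complex, 'n) vec \<Rightarrow> complex" where
  "denominator N s = (\<Prod>j\<in>UNIV. \<Prod>K<N. 1 - pole_term j s K)"

text \<open>The product of \<open>denominator N\<close> and \<open>summand k\<close> after
  cancellation. If the tail sum is below \<open>N\<close>, its factor is deleted from the finite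
  product; otherwise nothing is deleted and the inverse stays. In this form it makes sense as a
  holomorphic function across the zeros of the denominator.\<close>

definition cleared_summand :: "nat \<Rightarrow> ('n \<Rightarrow> nat) \<Rightarrow> (complex, 'n) vec \<Rightarrow> complex" where
  "cleared_summand N k s = binomial_factor k s *
     (\<Prod>j\<in>UNIV. pole_term j s (tail_sum k j) * (\<Prod>K\<in>{..<N} - {tail_sum k j}. 1 - pole_term j s K) *
       (if tail_sum k j < N then 1 else inverse (1 - pole_term j s (tail_sum k j))))"

lemma mv_differentiable_pole_term: "mv_differentiable_at (\<lambda>s. pole_term j s K) z"
  unfolding pole_term_def
  by (intro mv_differentiable_at_mult mv_differentiable_at_const mv_differentiable_pole_factor)

lemma mv_differentiable_one_minus_pole_term: "mv_differentiable_at (\<lambda>s. 1 - pole_term j s K) z"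
  unfolding pole_term_def pole_factor_def
  by (rule mv_differentiable_at_compose_sum[where \<phi> = "\<lambda>t. 1 - exp (lg j - of_real la * t) * of_real r ^ K"])
     (auto intro!: derivative_eq_intros)

lemma mv_differentiable_denominator: "mv_differentiable_at (denominator N) z"
  unfolding denominator_def
  by (intro mv_differentiable_at_prod mv_differentiable_one_minus_pole_term)

lemma mv_differentiable_cleared_summand:
  assumes "\<And>j K. N \<le> K \<Longrightarrow> pole_term j z K \<noteq> 1"
  shows "mv_differentiable_at (cleared_summand N k) z"
  unfolding cleared_summand_def
proof (intro mv_differentiable_at_mult mv_differentiable_at_prod mv_differentiable_binomial_factor
    mv_differentiable_one_minus_pole_term mv_differentiable_pole_term)
  fix j
  show "mv_differentiable_at (\<lambda>s. if tail_sum k j < N then 1 else inverse (1 - pole_term j s (tail_sum k j))) z"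
    using assms by (cases "tail_sum k j < N")
      (auto intro: mv_differentiable_at_const mv_differentiable_at_inverse mv_differentiable_one_minus_pole_term)
qed

text \<open>Cancellation happens separately for each \<open>j\<close>; off the zeros of the
  denominator every divisor with index below \<open>N\<close> is nonzero.\<close>

lemma denominator_mult_summand:
  assumes "denominator N s \<noteq> 0"
  shows "denominator N s * summand k s = cleared_summand N k s"
proof -
  have "(\<Prod>K<N. 1 - pole_term j s K) * (pole_term j s m / (1 - pole_term j s m)) =
      pole_term j s m * (\<Prod>K\<in>{..<N} - {m}. 1 - pole_term j s K) * (if m < N then 1 else inverse (1 - pole_term j s m))" for j m
  proof (cases "m < N")
    case True
    have "1 - pole_term j s m \<noteq> 0"
      using assms True unfolding denominator_def by (auto simp: prod_zero_iff)
    moreover have "(\<Prod>K<N. 1 - pole_term j s K) = (1 - pole_term j s m) * (\<Prod>K\<in>{..<N} - {m}. 1 - pole_term j s K)"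
      using True by (intro prod.remove) auto
    ultimately show ?thesis using True by simp
  next
    case False
    then show ?thesis by (simp add: divide_inverse)
  qed
  then show ?thesis
    unfolding summand_def cleared_summand_def denominator_def
    by (simp add: prod.distrib[symmetric] mult.left_commute)
qed

section \<open>Uniform bounds on unit balls and the local quotient\<close>

lemma norm_component_ball_le:
  fixes s p :: "(complex, 'n) vec"
  assumes "s \<in> ball p 1"
  shows "cmod (s $ i) \<le> norm p + 1"
  using Finite_Cartesian_Product.norm_nth_le[of s i] norm_triangle_ineq2[of s p] assms
  by (simp add: dist_norm norm_minus_commute)

lemma pole_factor_bounded:
  "\<exists>C>0. \<forall>s\<in>ball p 1. \<forall>j. cmod (pole_factor la lg j s) \<le> C"
proof -
  \<comment> \<open>Summing over all indices gives one bound valid for every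
    \<open>j\<close>.\<close>
  define C where "C = exp ((\<Sum>j\<in>UNIV. cmod (lg j)) + la * (\<Sum>i\<in>(UNIV :: 'n set). norm p + 1))"
  have "cmod (pole_factor la lg j s) \<le> C" if s: "s \<in> ball p 1" for s j
  proof -
    have "cmod (\<Sum>i\<in>{j..}. s $ i) \<le> (\<Sum>i\<in>{j..}. norm p + 1)"
      by (intro sum_norm_le norm_component_ball_le[OF s])
    also have "\<dots> \<le> (\<Sum>i\<in>(UNIV :: 'n set). norm p + 1)"
      by (intro sum_mono2) (auto intro: add_nonneg_nonneg)
    finally have "cmod (of_real la * (\<Sum>i\<in>{j..}. s $ i)) \<le> la * (\<Sum>i\<in>(UNIV :: 'n set). norm p + 1)"
      using la unfolding norm_mult by (intro mult_mono) auto
    moreover have "cmod (lg j) \<le> (\<Sum>j\<in>UNIV. cmod (lg j))"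
      by (rule member_le_sum) auto
    ultimately have "cmod (lg j - of_real la * (\<Sum>i\<in>{j..}. s $ i)) \<le>
        (\<Sum>j\<in>UNIV. cmod (lg j)) + la * (\<Sum>i\<in>(UNIV :: 'n set). norm p + 1)"
      using norm_triangle_ineq4[of "lg j" "of_real la * (\<Sum>i\<in>{j..}. s $ i)"] by linarith
    then show "cmod (pole_factor la lg j s) \<le> C"
      unfolding pole_factor_def C_def by (intro order_trans[OF norm_exp]) simp
  qed
  moreover have "0 < C" by (simp add: C_def)
  ultimately show ?thesis by blast
qed

text \<open>From \<open>N\<close> on, |y_j| <= 1/2, so each surviving inverse is at most 2; the at
  most \<open>N\<close> remaining factors are each at most 1 + C. Weakening |r|^(k_j+...+k_d) to
  |r|^(k_j) makes the bound a product over coordinates.\<close>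

lemma cleared_summand_bound:
  assumes C: "\<And>j. cmod (pole_factor la lg j s) \<le> C" and N: "C * \<bar>r\<bar> ^ N \<le> 1 / 2"
    and R: "\<And>i. cmod (s $ i) \<le> R"
  shows "\<And>j K. N \<le> K \<Longrightarrow> cmod (pole_term j s K) \<le> 1 / 2"
    and "cmod (cleared_summand N k s) \<le>
      (\<Prod>i\<in>UNIV. pochhammer R (k i) / fact (k i) * (C * (1 + C) ^ N * 2 * \<bar>r\<bar> ^ k i))"
proof -
  have C0: "0 \<le> C" using C norm_ge_zero order_trans by blast
  have rpow: "\<bar>r\<bar> ^ m \<le> \<bar>r\<bar> ^ n" if "n \<le> m" for m n
    using that r by (intro power_decreasing) auto
  have c_le: "cmod (pole_term j s K) \<le> C * \<bar>r\<bar> ^ K" for j K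
    using C[of j] by (simp add: pole_term_def norm_mult norm_power mult_right_mono)
  show half: "cmod (pole_term j s K) \<le> 1 / 2" if "N \<le> K" for j K
    using c_le[of j K] mult_left_mono[OF rpow[OF that] C0] N by linarith
  have le_C: "cmod (1 - pole_term j s K) \<le> 1 + C" for j K
    using c_le[of j K] mult_left_mono[OF rpow[of 0 K] C0] norm_triangle_ineq4[of 1 "pole_term j s K"] by simp
  have inv: "cmod (if m < N then 1 else inverse (1 - pole_term j s m)) \<le> 2" for j m
  proof (cases "m < N")
    case False
    then have "1 / 2 \<le> cmod (1 - pole_term j s m)"
      using half[of m j] norm_triangle_ineq2[of 1 "pole_term j s m"] by simp
    then have "inverse (cmod (1 - pole_term j s m)) \<le> inverse (1 / 2)"
      by (intro le_imp_inverse_le) auto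
    then show ?thesis using False by (simp add: norm_inverse)
  qed simp
  have prod_le: "cmod (\<Prod>K\<in>{..<N} - {m}. 1 - pole_term j s K) \<le> (1 + C) ^ N" for j m
  proof -
    have "cmod (\<Prod>K\<in>{..<N} - {m}. 1 - pole_term j s K) \<le> (\<Prod>K\<in>{..<N} - {m}. 1 + C)"
      unfolding prod_norm[symmetric] by (intro prod_mono) (simp add: le_C)
    also have "\<dots> = (1 + C) ^ card ({..<N} - {m})" by simp
    also have "\<dots> \<le> (1 + C) ^ N"
      using C0 card_mono[of "{..<N}" "{..<N} - {m}"] by (intro power_increasing) auto
    finally show ?thesis .
  qed
  have factor: "cmod (pole_term j s (tail_sum k j) * (\<Prod>K\<in>{..<N} - {tail_sum k j}. 1 - pole_term j s K) *
       (if tail_sum k j < N then 1 else inverse (1 - pole_term j s (tail_sum k j)))) \<le>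
       C * \<bar>r\<bar> ^ k j * (1 + C) ^ N * 2" for j
    unfolding norm_mult
    using c_le[of j "tail_sum k j"] mult_left_mono[OF rpow[OF le_tail_sum[of k j]] C0] C0
    by (intro mult_mono prod_le inv) auto
  have "0 \<le> R" using R norm_ge_zero order_trans by blast
  then have poch: "0 \<le> pochhammer R m / fact m" for m
    by (simp add: pochhammer_prod prod_nonneg)
  have "cmod (cleared_summand N k s) \<le> (\<Prod>i\<in>UNIV. pochhammer R (k i) / fact (k i)) *
      (\<Prod>j\<in>UNIV. C * \<bar>r\<bar> ^ k j * (1 + C) ^ N * 2)"
    unfolding cleared_summand_def binomial_factor_def norm_mult[of "prod _ _"] prod_norm[symmetric]
    using norm_gbinomial_le[of "- (s $ _)" R] R factor
    by (intro mult_mono prod_mono) (auto simp: norm_mult norm_power intro!: prod_nonneg poch)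
  also have "\<dots> = (\<Prod>i\<in>UNIV. pochhammer R (k i) / fact (k i) * (C * (1 + C) ^ N * 2 * \<bar>r\<bar> ^ k i))"
    by (simp add: prod.distrib[symmetric] mult_ac)
  finally show "cmod (cleared_summand N k s) \<le>
      (\<Prod>i\<in>UNIV. pochhammer R (k i) / fact (k i) * (C * (1 + C) ^ N * 2 * \<bar>r\<bar> ^ k i))" .
qed

text \<open>The majorant factors over the coordinates, each contributing \<open>B\<close> times the
  binomial series of (1 - |r|)^(-R).\<close>

lemma summable_binomial_majorant:
  fixes B :: real
  assumes "0 \<le> R" and "0 \<le> B"
  shows "(\<lambda>k :: 'n \<Rightarrow> nat. \<Prod>i\<in>UNIV. pochhammer R (k i) / fact (k i) * (B * \<bar>r\<bar> ^ k i)) summable_on UNIV"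
proof -
  have "(\<lambda>m. pochhammer R m / fact m * (B * \<bar>r\<bar> ^ m)) summable_on UNIV"
    using summable_on_cmult_right[OF summable_pochhammer_powers[of R "\<bar>r\<bar>"], of B] assms r
    by (simp add: mult_ac)
  moreover have "0 \<le> pochhammer R m / fact m * (B * \<bar>r\<bar> ^ m)" for m
    using assms by (simp add: pochhammer_prod prod_nonneg)
  ultimately show ?thesis
    using summable_on_prod_funs[where B = "\<lambda>_::'n. UNIV"
        and f = "\<lambda>_ m. pochhammer R m / fact m * (B * \<bar>r\<bar> ^ m)"] by simp
qed

text \<open>A single \<open>N\<close> with C |r|^N <= 1/2 works on the whole ball, so finitely many
  factors clear all poles there and the Weierstrass test applies to the cleared series.\<close>

lemma local_quotient:
  "\<exists>N G. mv_holomorphic_on G (ball p 1) \<and>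
     (\<forall>s\<in>ball p 1. denominator N s \<noteq> 0 \<longrightarrow> continuation s = G s / denominator N s) \<and>
     (\<forall>s\<in>ball p 1. \<forall>j. \<forall>K\<ge>N. pole_term j s K \<noteq> 1)"
proof -
  obtain C where C: "0 < C" "\<And>s j. s \<in> ball p 1 \<Longrightarrow> cmod (pole_factor la lg j s) \<le> C"
    using pole_factor_bounded[of p] by blast
  obtain N where "\<bar>r\<bar> ^ N < 1 / 2 / C"
    using real_arch_pow_inv[of "1 / 2 / C" "\<bar>r\<bar>"] C(1) r by auto
  then have N: "C * \<bar>r\<bar> ^ N \<le> 1 / 2"
    using C(1) by (simp add: field_simps)
  note R = norm_component_ball_le[of _ p]
  note bound = cleared_summand_bound[OF C(2) N R]
  define S where "S s = (\<Sum>\<^sub>\<infinity>k. cleared_summand N k s)" for s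
  have ne: "pole_term j s K \<noteq> 1" if "s \<in> ball p 1" "N \<le> K" for s j K
    using bound(1)[OF that(1) that(1) that(2), of j] by auto
  have inf: "infinite (UNIV :: ('n \<Rightarrow> nat) set)"
    by (metis finite_fun_UNIVD2 infinite_UNIV_nat)
  have hol: "mv_holomorphic_on S (ball p 1)"
    unfolding S_def
  proof (rule mv_holomorphic_on_infsum[OF inf])
    show "mv_holomorphic_on (cleared_summand N k) (ball p 1)" for k
      unfolding mv_holomorphic_on_iff using ne by (auto intro: mv_differentiable_cleared_summand)
    show "cmod (cleared_summand N k s) \<le>
        (\<Prod>i\<in>UNIV. pochhammer (norm p + 1) (k i) / fact (k i) * (C * (1 + C) ^ N * 2 * \<bar>r\<bar> ^ k i))"
      if "s \<in> ball p 1" for k s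
      by (rule bound(2)) (rule that)+
    show "(\<lambda>k :: 'n \<Rightarrow> nat. \<Prod>i\<in>UNIV. pochhammer (norm p + 1) (k i) / fact (k i) *
        (C * (1 + C) ^ N * 2 * \<bar>r\<bar> ^ k i)) summable_on UNIV"
      using C(1) by (intro summable_binomial_majorant) auto
  qed
  define G where "G s = exp (of_real A * (\<Sum>i\<in>UNIV. s $ i)) * S s" for s
  have "mv_differentiable_at (\<lambda>s. exp (of_real A * (\<Sum>i\<in>UNIV. s $ i))) z" for z :: "(complex, 'n) vec"
    by (rule mv_differentiable_at_compose_sum[where \<phi> = "\<lambda>t. exp (of_real A * t)"])
       (auto intro!: derivative_eq_intros)
  then have "mv_holomorphic_on G (ball p 1)"
    using hol unfolding mv_holomorphic_on_iff G_def by (simp add: mv_differentiable_at_mult)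
  moreover have "continuation s = G s / denominator N s" if "denominator N s \<noteq> 0" for s
  proof -
    \<comment> \<open>At a fixed point the denominator does not depend on \<open>k\<close>, so it
      moves through the sum.\<close>
    have "S s = denominator N s * (\<Sum>\<^sub>\<infinity>k. summand k s)"
      unfolding S_def infsum_cmult_right'[symmetric] by (simp add: denominator_mult_summand[OF that])
    then show ?thesis using that by (simp add: continuation_def G_def)
  qed
  ultimately show ?thesis
    using ne by (intro exI[of _ N] exI[of _ G] conjI ballI allI impI) auto
qed

section \<open>Holomorphy off the pole set and meromorphy\<close>

lemma denominator_nonzero_iff:
  assumes "\<And>j K. N \<le> K \<Longrightarrow> pole_term j s K \<noteq> 1"
  shows "denominator N s \<noteq> 0 \<longleftrightarrow> (\<forall>j K. pole_term j s K \<noteq> 1)"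
proof -
  have "denominator N s \<noteq> 0 \<longleftrightarrow> (\<forall>j. \<forall>K<N. pole_term j s K \<noteq> 1)"
    unfolding denominator_def by (auto simp: prod_zero_iff)
  then show ?thesis using assms by (meson not_less)
qed

text \<open>At a point off the poles the local denominator is nonzero, hence nonzero nearby by
  continuity. This yields at once that the complement of the poles is open and that the quotient is
  differentiable.\<close>

lemma continuation_holomorphic: "mv_holomorphic_on continuation {s. \<forall>j K. pole_term j s K \<noteq> 1}"
proof -
  have "\<exists>T. open T \<and> p \<in> T \<and> T \<subseteq> {s. \<forall>j K. pole_term j s K \<noteq> 1} \<and> mv_differentiable_at continuation p"
    if p: "\<forall>j K. pole_term j p K \<noteq> 1" for p
  proof -
    obtain N G where G: "mv_holomorphic_on G (ball p 1)"
      "\<forall>s\<in>ball p 1. denominator N s \<noteq> 0 \<longrightarrow> continuation s = G s / denominator N s"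
      "\<forall>s\<in>ball p 1. \<forall>j. \<forall>K\<ge>N. pole_term j s K \<noteq> 1"
      using local_quotient[of p] by blast
    define T where "T = ball p 1 \<inter> {s. denominator N s \<noteq> 0}"
    have "continuous_on UNIV (denominator N)"
      using mv_differentiable_denominator has_derivative_continuous
      unfolding mv_differentiable_at_def continuous_on_eq_continuous_at[OF open_UNIV] by fast
    then have T: "open T"
      unfolding T_def by (intro open_Int open_ball open_Collect_neq continuous_on_const)
    have nz: "denominator N s \<noteq> 0 \<longleftrightarrow> (\<forall>j K. pole_term j s K \<noteq> 1)" if "s \<in> ball p 1" for s
      using that G(3) by (intro denominator_nonzero_iff) blast
    have pT: "p \<in> T" using nz[of p] p by (simp add: T_def)
    have "mv_differentiable_at (\<lambda>s. G s / denominator N s) p"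
      using G(1) pT by (intro mv_differentiable_at_divide mv_differentiable_denominator)
        (auto simp: T_def mv_holomorphic_on_iff)
    then have "mv_differentiable_at continuation p"
      by (rule mv_differentiable_at_cong[OF _ T pT]) (use G(2) in \<open>auto simp: T_def\<close>)
    moreover have "T \<subseteq> {s. \<forall>j K. pole_term j s K \<noteq> 1}"
      using nz by (auto simp: T_def)
    ultimately show ?thesis using T pT by blast
  qed
  note local = this
  have "open {s. \<forall>j K. pole_term j s K \<noteq> 1}"
    by (subst open_subopen) (use local in fast)
  moreover have "\<forall>z\<in>{s. \<forall>j K. pole_term j s K \<noteq> 1}. mv_differentiable_at continuation z"
    using local by fast
  ultimately show ?thesis unfolding mv_holomorphic_on_iff by blast
qed

text \<open>Along the real diagonal p + t(1,...,1) each |y_j| is a strictly decreasing exponential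
  in t, so it equals 1 for only one t. Finitely many pairs (j, K) exclude finitely many t.\<close>

lemma denominator_nonzero_in_ball: "\<exists>z\<in>ball p 1. denominator N z \<noteq> 0"
proof -
  define q where "q t = p + of_real t *s (1 :: (complex, 'n) vec)" for t :: real
  define a where "a j = Re (lg j - of_real la * (\<Sum>i\<in>{j..}. p $ i))" for j
  define b where "b j = la * real (card {j..})" for j :: 'n
  have b: "0 < b j" for j using la by (auto simp: b_def card_gt_0_iff)
  have norm_c: "cmod (pole_term j (q t) K) = exp (a j - b j * t) * \<bar>r\<bar> ^ K" for j t K
    by (simp add: pole_term_def pole_factor_def q_def a_def b_def norm_mult norm_power sum.distrib algebra_simps)
  \<comment> \<open>The solutions t of |y_j| = 1, that is, of a_j - b_j t + K ln|r| = 0.\<close>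
  define bad where "bad = (\<lambda>(j, K). (a j + real K * ln \<bar>r\<bar>) / b j) ` (UNIV \<times> {..<N})"
  define \<epsilon> where "\<epsilon> = 1 / (norm (1 :: (complex, 'n) vec) + 1)"
  have "0 < \<epsilon>" by (simp add: \<epsilon>_def add_nonneg_pos)
  then have "infinite {0<..<\<epsilon>}" by (rule infinite_Ioo)
  moreover have "finite bad" by (simp add: bad_def)
  ultimately have "infinite ({0<..<\<epsilon>} - bad)" by simp
  then obtain t where "t \<in> {0<..<\<epsilon>} - bad"
    using infinite_imp_nonempty by blast
  then have t: "0 < t" "t < \<epsilon>" "t \<notin> bad" by auto
  have "t * norm (1 :: (complex, 'n) vec) \<le> t * (norm (1 :: (complex, 'n) vec) + 1)"
    using t by simp
  also have "\<dots> < 1"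
    using t(2) by (simp add: \<epsilon>_def pos_less_divide_eq add_nonneg_pos)
  finally have "q t \<in> ball p 1"
    using t by (simp add: q_def dist_norm norm_vector_scalar_mult)
  moreover have "pole_term j (q t) K \<noteq> 1" if "K < N" for j K
  proof
    assume "pole_term j (q t) K = 1"
    then have "exp (a j - b j * t) * \<bar>r\<bar> ^ K = 1" using norm_c[of j t K] by simp
    moreover have "\<bar>r\<bar> ^ K = exp (real K * ln \<bar>r\<bar>)"
      using r by (simp add: exp_of_nat_mult)
    ultimately have "exp (a j - b j * t + real K * ln \<bar>r\<bar>) = 1" by (simp add: exp_add)
    then have "t = (a j + real K * ln \<bar>r\<bar>) / b j" using b[of j] by (simp add: field_simps)
    then have "t \<in> bad"
      unfolding bad_def using that by (intro image_eqI[of _ _ "(j, K)"]) simp_all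
    then show False using t by blast
  qed
  then have "denominator N (q t) \<noteq> 0"
    by (simp add: denominator_def prod_zero_iff)
  ultimately show ?thesis by blast
qed

lemma continuation_meromorphic: "mv_meromorphic_on continuation UNIV"
  unfolding mv_meromorphic_on_def
proof
  fix p
  obtain N G where "mv_holomorphic_on G (ball p 1)"
    "\<forall>s\<in>ball p 1. denominator N s \<noteq> 0 \<longrightarrow> continuation s = G s / denominator N s"
    using local_quotient[of p] by blast
  moreover have "mv_holomorphic_on (denominator N) (ball p 1)"
    by (simp add: mv_holomorphic_on_iff mv_differentiable_denominator)
  ultimately show "\<exists>W g h. open W \<and> connected W \<and> p \<in> W \<and> W \<subseteq> UNIV \<and>
        mv_holomorphic_on g W \<and> mv_holomorphic_on h W \<and> (\<exists>z\<in>W. h z \<noteq> 0) \<and>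
        (\<forall>z\<in>W. h z \<noteq> 0 \<longrightarrow> continuation z = g z / h z)"
    using denominator_nonzero_in_ball[of p N]
    by (intro exI[of _ "ball p 1"] exI[of _ G] exI[of _ "denominator N"]) auto
qed

text \<open>Expanding the powers gives a double family over n and k with the separated majorant
  \<open>A' n * B k\<close>. Absolute summability permits exchanging the sums, and for fixed k the
  sum over n consists of geometric series.\<close>

lemma sum_over_indices:
  fixes x :: "'n \<Rightarrow> complex" and s :: "(complex, 'n) vec"
  assumes x: "\<And>j. (\<Prod>i\<in>{j..}. x i) = pole_factor la lg j s"
    and lt: "\<And>j. cmod (pole_factor la lg j s) < 1"
  defines "t \<equiv> \<lambda>n :: 'n \<Rightarrow> nat. \<Prod>i\<in>UNIV. x i ^ n i * (1 - of_real r ^ n i) powr (- (s $ i))"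
  shows "(\<lambda>n. cmod (t n)) summable_on lucas_L_indices"
    and "infsum t lucas_L_indices = (\<Sum>\<^sub>\<infinity>k. summand k s)"
proof -
  define R where "R = norm s"
  have R: "cmod (- (s $ i)) \<le> R" for i
    by (simp add: R_def Finite_Cartesian_Product.norm_nth_le)
  define g where "g i m k = (- (s $ i) gchoose k) * (- (of_real r ^ m)) ^ k" for i m k
  define B where "B k = (\<Prod>i\<in>UNIV. pochhammer R (k i) / fact (k i) * (1 * \<bar>r\<bar> ^ k i))" for k :: "'n \<Rightarrow> nat"
  define A' where "A' n = cmod (\<Prod>i\<in>UNIV. x i ^ n i)" for n :: "'n \<Rightarrow> nat"
  define E where "E n k = (\<Prod>i\<in>UNIV. x i ^ n i * g i (n i) (k i))" for n k :: "'n \<Rightarrow> nat"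
  \<comment> \<open>For m >= 1, |r|^m <= |r| removes the dependence on the multi-index n from the
    majorant.\<close>
  have g_le: "cmod (g i m k) \<le> pochhammer R k / fact k * (1 * \<bar>r\<bar> ^ k)" if "0 < m" for i m k
  proof -
    have "cmod ((- (of_real r ^ m)) ^ k) = (\<bar>r\<bar> ^ m) ^ k"
      by (simp add: norm_power)
    also have "\<dots> \<le> (\<bar>r\<bar> ^ 1) ^ k"
      using that r by (intro power_mono power_decreasing) auto
    finally show ?thesis
      unfolding g_def norm_mult using norm_gbinomial_le[OF R]
      by (intro mult_mono) (auto intro: order_trans[OF norm_ge_zero])
  qed
  have poch: "0 \<le> pochhammer R m / fact m * (1 * \<bar>r\<bar> ^ m)" for m
    using norm_ge_zero[of s] by (simp add: R_def pochhammer_prod prod_nonneg)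
  have B: "B summable_on UNIV"
    unfolding B_def by (rule summable_binomial_majorant) (auto simp: R_def)
  have B0: "0 \<le> B k" for k unfolding B_def by (intro prod_nonneg poch)
  \<comment> \<open>The extra factor |r|^(k_j+...+k_d) is at most 1, so the geometric series
    converge for every k.\<close>
  have lt': "cmod (\<Prod>i\<in>{j..}. x i * of_real r ^ k i) < 1" for j and k :: "'n \<Rightarrow> nat"
  proof -
    have "cmod (\<Prod>i\<in>{j..}. x i * of_real r ^ k i) = cmod (pole_factor la lg j s) * \<bar>r\<bar> ^ tail_sum k j"
      by (simp add: prod.distrib x norm_mult norm_power tail_sum_def power_sum prod_norm[symmetric])
    also have "\<dots> \<le> cmod (pole_factor la lg j s) * 1"
      using r by (intro mult_left_mono power_le_one) auto
    finally show ?thesis using lt[of j] by simp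
  qed
  have A: "A' summable_on lucas_L_indices"
    unfolding A'_def using lt by (intro sum_prod_powers_indices(1)) (simp add: x)
  have E_le: "cmod (E n k) \<le> A' n * B k" if "n \<in> lucas_L_indices" for n k
  proof -
    have pos: "0 < n i" for i using that by (simp add: lucas_L_indices_def)
    have "cmod (E n k) = A' n * (\<Prod>i\<in>UNIV. cmod (g i (n i) (k i)))"
      by (simp add: E_def A'_def prod.distrib norm_mult prod_norm)
    also have "\<dots> \<le> A' n * B k"
      unfolding B_def by (intro mult_left_mono prod_mono) (auto simp: A'_def intro: g_le[OF pos, simplified])
    finally show ?thesis .
  qed
  have "(\<lambda>(n, k). A' n * B k) summable_on lucas_L_indices \<times> UNIV"
  proof (rule summable_on_SigmaI)
    show "((\<lambda>k. case (n, k) of (n, k) \<Rightarrow> A' n * B k) has_sum A' n * infsum B UNIV) UNIV" for n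
      using has_sum_cmult_right[OF has_sum_infsum[OF B]] by simp
    show "(\<lambda>n. A' n * infsum B UNIV) summable_on lucas_L_indices"
      by (rule summable_on_cmult_left[OF A])
  qed (auto simp: A'_def B0)
  then have "(\<lambda>p. cmod (case p of (n, k) \<Rightarrow> E n k)) summable_on lucas_L_indices \<times> UNIV"
    by (rule Infinite_Sum.abs_summable_on_comparison_test') (auto simp: E_le)
  then have E_sum: "(\<lambda>(n, k). E n k) summable_on lucas_L_indices \<times> UNIV"
    by (rule abs_summable_summable)
  have E_t: "(E n has_sum t n) UNIV" if n: "n \<in> lucas_L_indices" for n
  proof -
    have pos: "0 < n i" for i using n by (simp add: lucas_L_indices_def)
    have g_sum: "(\<lambda>k. cmod (g i (n i) k)) summable_on UNIV" for i
    proof (rule Infinite_Sum.abs_summable_on_comparison_test')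
      show "(\<lambda>k. pochhammer R k / fact k * (1 * \<bar>r\<bar> ^ k)) summable_on UNIV"
        using summable_pochhammer_powers[of R "\<bar>r\<bar>"] r by (simp add: R_def)
    qed (rule g_le[OF pos])
    have "infsum (g i (n i)) UNIV = (1 - of_real r ^ n i) powr (- (s $ i))" for i
    proof -
      have "cmod (- (of_real r ^ n i)) < 1"
        using r pos[of i] by (simp add: norm_power power_less_one_iff)
      from gen_binomial_complex[OF this, of "- (s $ i)"]
      have "g i (n i) sums (1 - of_real r ^ n i) powr (- (s $ i))"
        by (simp add: g_def[abs_def])
      then show ?thesis
        using norm_summable_imp_has_sum[OF summable_on_imp_summable[OF g_sum[of i]]] infsumI by blast
    qed
    then have "t n = (\<Prod>i\<in>UNIV. infsum (\<lambda>k. x i ^ n i * g i (n i) k) UNIV)"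
      by (simp add: t_def infsum_cmult_right')
    also have "\<dots> = infsum (E n) UNIV"
    proof -
      have "(\<lambda>k. cmod (x i ^ n i * g i (n i) k)) summable_on UNIV" for i
        unfolding norm_mult by (rule summable_on_cmult_right[OF g_sum])
      from infsum_prod_funs[where B = "\<lambda>_. UNIV" and f = "\<lambda>i k. x i ^ n i * g i (n i) k", OF this]
      show ?thesis by (simp add: E_def[abs_def])
    qed
    finally show ?thesis
      using summable_on_SigmaD1[OF E_sum n] by (simp add: has_sum_infsum)
  qed
  have "cmod (t n) \<le> A' n * infsum B UNIV" if "n \<in> lucas_L_indices" for n
    using norm_infsum_le[OF E_t[OF that] has_sum_cmult_right[OF has_sum_infsum[OF B]] E_le[OF that]] .
  then show "(\<lambda>n. cmod (t n)) summable_on lucas_L_indices"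
    by (rule Infinite_Sum.abs_summable_on_comparison_test'[OF summable_on_cmult_left[OF A]])
  have "infsum t lucas_L_indices = (\<Sum>\<^sub>\<infinity>n\<in>lucas_L_indices. \<Sum>\<^sub>\<infinity>k. E n k)"
    by (intro infsum_cong) (use E_t infsumI in fastforce)
  also have "\<dots> = (\<Sum>\<^sub>\<infinity>k. \<Sum>\<^sub>\<infinity>n\<in>lucas_L_indices. E n k)"
    by (rule infsum_swap_banach[OF E_sum])
  also have "\<dots> = (\<Sum>\<^sub>\<infinity>k. summand k s)"
  proof (intro infsum_cong)
    fix k :: "'n \<Rightarrow> nat"
    \<comment> \<open>Regrouping (r^m)^l as (r^l)^m turns the summand into an m-th power with ratio
      x_i r^l.\<close>
    have "x i ^ m * g i m l = ((- (s $ i) gchoose l) * (-1) ^ l) * (x i * of_real r ^ l) ^ m" for i m l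
      by (simp add: g_def power_minus[of "of_real r ^ m"] power_mult_distrib mult_ac flip: power_mult)
    then have "E n k = binomial_factor k s * (\<Prod>i\<in>UNIV. (x i * of_real r ^ k i) ^ n i)" for n
      by (simp add: E_def binomial_factor_def prod.distrib)
    then have "(\<Sum>\<^sub>\<infinity>n\<in>lucas_L_indices. E n k) =
        binomial_factor k s * (\<Sum>\<^sub>\<infinity>n\<in>lucas_L_indices. \<Prod>i\<in>UNIV. (x i * of_real r ^ k i) ^ n i)"
      by (simp add: infsum_cmult_right')
    also have "\<dots> = summand k s"
      unfolding sum_prod_powers_indices(2)[of "\<lambda>i. x i * of_real r ^ k i", OF lt'] summand_def
      by (simp add: prod.distrib x pole_term_def tail_sum_def power_sum)
    finally show "(\<Sum>\<^sub>\<infinity>n\<in>lucas_L_indices. E n k) = summand k s" .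
  qed
  finally show "infsum t lucas_L_indices = (\<Sum>\<^sub>\<infinity>k. summand k s)" .
qed

end

section \<open>The Lucas sequence\<close>

text \<open>The key identity is D - (P - 2)^2 = 4(P - 1 - Q). For P <= 2 it gives sqrt D > 2 - P,
  hence \<alpha> > 1; for P > 2 it gives D > 0, and \<alpha> > P/2 > 1. Then P > 0 and sqrt D > 0
  give |\<beta>| < \<alpha>.\<close>

lemma lucas_roots:
  assumes "P > 0" and "Q \<noteq> 0" and "P \<le> 2 \<Longrightarrow> Q < P - 1" and "P > 2 \<Longrightarrow> Q \<le> P - 1"
  shows "1 < lucas_alpha P Q" and "lucas_beta P Q < lucas_alpha P Q"
    and "\<bar>lucas_beta P Q / lucas_alpha P Q\<bar> < 1" and "lucas_beta P Q / lucas_alpha P Q = Q / (lucas_alpha P Q)\<^sup>2"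
proof -
  define d where "d = sqrt (P\<^sup>2 - 4 * Q)"
  have D: "(P - 2)\<^sup>2 \<le> P\<^sup>2 - 4 * Q" "P \<le> 2 \<Longrightarrow> (P - 2)\<^sup>2 < P\<^sup>2 - 4 * Q"
    using assms by (cases "P \<le> 2"; simp add: power2_eq_square algebra_simps)+
  have D0: "0 < P\<^sup>2 - 4 * Q"
  proof (cases "P \<le> 2")
    case True
    then show ?thesis using D(2) zero_le_power2[of "P - 2"] by linarith
  next
    case False
    then have "0 < (P - 2)\<^sup>2" by simp
    then show ?thesis using D(1) by linarith
  qed
  have d: "0 < d" "d\<^sup>2 = P\<^sup>2 - 4 * Q" using D0 by (simp_all add: d_def)
  have ab: "lucas_alpha P Q = (P + d) / 2" "lucas_beta P Q = (P - d) / 2"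
    by (simp_all add: lucas_alpha_def lucas_beta_def d_def)
  show one: "1 < lucas_alpha P Q"
  proof (cases "P \<le> 2")
    case True
    then have "(2 - P)\<^sup>2 < d\<^sup>2" using D(2) d by (simp add: power2_commute)
    then have "2 - P < d" using d(1) power2_less_imp_less[of "2 - P" d] by simp
    then show ?thesis by (simp add: ab)
  next
    case False
    then show ?thesis using d by (simp add: ab)
  qed
  show "lucas_beta P Q < lucas_alpha P Q" using d by (simp add: ab)
  have "\<bar>lucas_beta P Q\<bar> < lucas_alpha P Q" using d assms(1) by (simp add: ab abs_less_iff field_simps)
  then show "\<bar>lucas_beta P Q / lucas_alpha P Q\<bar> < 1" using one by (simp add: abs_divide)
  have "lucas_alpha P Q * lucas_beta P Q = (P\<^sup>2 - d\<^sup>2) / 4"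
    by (simp add: ab power2_eq_square algebra_simps)
  then have "lucas_alpha P Q * lucas_beta P Q = Q" by (simp add: d)
  then show "lucas_beta P Q / lucas_alpha P Q = Q / (lucas_alpha P Q)\<^sup>2"
    using one by (simp add: field_simps power2_eq_square)
qed

lemma additive_character_of_nat:
  assumes "additive_character h"
  shows "h (int m) = h 1 ^ m"
proof (induction m)
  case 0
  have "h (0 + 0) = h 0 * h 0" "h 0 \<noteq> 0" using assms unfolding additive_character_def by blast+
  then show ?case by simp
next
  case (Suc m)
  have "h (int (Suc m)) = h (1 + int m)" by simp
  also have "\<dots> = h 1 * h (int m)" using assms unfolding additive_character_def by blast
  finally show ?case using Suc by simp
qed

text \<open>The hyperplane equation is the logarithm of y_j = 1: |Q|/a^2 is the modulus of
  \<open>r\<close>, and the term with \<open>lucas_ell\<close> supplies the sign (-1)^K when Q <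
  0.\<close>

lemma lucas_L_hyperplane_iff:
  fixes P Q :: real and s :: "complex ^ ('n :: {finite, linorder})"
  defines "a \<equiv> lucas_alpha P Q"
  assumes a: "1 < a" and Q: "Q \<noteq> 0" and r: "r = Q / a\<^sup>2"
  shows "(\<exists>n. s \<in> lucas_L_hyperplane P Q (lg j) j k n) \<longleftrightarrow>
    pole_factor (ln a) lg j s * of_real r ^ tail_sum k j = 1"
proof -
  define K where "K = tail_sum k j"
  define la where "la = complex_of_real (ln a)"
  define \<sigma> where "\<sigma> = (\<Sum>i\<in>{j..}. s $ i)"
  define ell where "ell = lucas_ell Q K"
  \<comment> \<open>A logarithm of y_j, obtained by multiplying the hyperplane equation by
    \<open>la\<close> and collecting all terms except 2 n pi i.\<close>
  define w where "w = lg j - la * \<sigma> + of_nat K * (of_real (ln \<bar>Q\<bar>) - 2 * la) + of_nat ell * (of_real pi * \<i>)"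
  have la: "la \<noteq> 0" using a by (simp add: la_def)
  have abs_r: "exp (of_real (ln \<bar>Q\<bar>) - 2 * la) = complex_of_real (\<bar>Q\<bar> / a\<^sup>2)"
  proof -
    have "exp (ln \<bar>Q\<bar> - 2 * ln a) = \<bar>Q\<bar> / a\<^sup>2"
      using a Q by (simp add: exp_diff exp_double)
    then show ?thesis
      by (metis exp_of_real la_def of_real_diff of_real_mult of_real_numeral)
  qed
  have sign: "exp (of_nat ell * (of_real pi * \<i>)) = complex_of_real (if Q < 0 then (-1) ^ K else 1)"
    unfolding exp_of_nat_mult by (simp add: exp_pi_i ell_def lucas_ell_def)
  have "exp w = exp (lg j - la * \<sigma>) * (of_real (\<bar>Q\<bar> / a\<^sup>2) ^ K * of_real (if Q < 0 then (-1) ^ K else 1))"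
    unfolding w_def exp_add sign unfolding exp_of_nat_mult abs_r by simp
  also have "of_real (\<bar>Q\<bar> / a\<^sup>2) ^ K * of_real (if Q < 0 then (-1) ^ K else 1) = complex_of_real (r ^ K)"
  proof -
    have "(\<bar>Q\<bar> / a\<^sup>2) ^ K * (if Q < 0 then (-1) ^ K else 1) = r ^ K"
      by (simp add: r power_mult_distrib[symmetric])
    then show ?thesis by (metis of_real_mult of_real_power)
  qed
  finally have w: "exp w = pole_factor (ln a) lg j s * of_real r ^ tail_sum k j"
    by (simp add: pole_factor_def la_def \<sigma>_def K_def)
  \<comment> \<open>The minus sign arises because \<open>w\<close> contains
    -\<open>la * \<sigma>\<close>; ranging over all integers absorbs it.\<close>
  have mem: "s \<in> lucas_L_hyperplane P Q (lg j) j k n \<longleftrightarrow> w = of_int (2 * - n) * of_real pi * \<i>" for n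
  proof -
    define X where "X = lg j + of_nat K * (of_real (ln \<bar>Q\<bar>) - 2 * la)
        + (2 * of_int n + of_nat ell) * (complex_of_real pi * \<i>)"
    have "s \<in> lucas_L_hyperplane P Q (lg j) j k n \<longleftrightarrow>
        \<sigma> = - 2 * of_nat K + lg j / la + of_nat K * (complex_of_real (ln \<bar>Q\<bar>) / la)
            + (2 * of_int n + of_nat ell) * (complex_of_real pi * \<i> / la)"
      by (simp add: lucas_L_hyperplane_def Let_def \<sigma>_def K_def tail_sum_def la_def a_def ell_def)
    also have "\<dots> \<longleftrightarrow> \<sigma> = X / la"
      using la by (simp add: X_def add_divide_distrib diff_divide_distrib right_diff_distrib)
        (simp add: algebra_simps)
    also have "\<dots> \<longleftrightarrow> la * \<sigma> = X"
      using la by (simp add: nonzero_eq_divide_eq mult.commute)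
    also have "\<dots> \<longleftrightarrow> w = of_int (2 * - n) * of_real pi * \<i>"
      unfolding w_def X_def by (auto simp: algebra_simps)
    finally show ?thesis .
  qed
  have "exp w = 1 \<longleftrightarrow> (\<exists>m. w = of_int (2 * m) * of_real pi * \<i>)"
    using exp_eq[of w 0] by simp
  also have "\<dots> \<longleftrightarrow> (\<exists>n. w = of_int (2 * - n) * of_real pi * \<i>)"
    by (metis minus_minus)
  finally show ?thesis using mem w by simp
qed

text \<open>Write U_m = a^m q / (a - b) with q = 1 - (b/a)^m. Since |b/a| < 1 and m > 0, q is
  positive even for negative b, so all logarithms are real and the complex power splits without
  branch ambiguity.\<close>

lemma lucas_factor:
  fixes P Q :: real and z y :: complex
  defines "a \<equiv> lucas_alpha P Q" and "b \<equiv> lucas_beta P Q"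
  assumes a: "1 < a" and ba: "b < a" and r: "\<bar>b / a\<bar> < 1" and m: "0 < m"
  shows "y ^ m / of_real (lucas_U P Q m) powr z =
    exp (of_real (ln (a - b)) * z) *
      ((y * exp (- of_real (ln a) * z)) ^ m * (1 - of_real (b / a) ^ m) powr (- z))"
proof -
  define q where "q = 1 - (b / a) ^ m"
  have "\<bar>(b / a) ^ m\<bar> < 1"
    using r m unfolding power_abs by (simp add: power_less_one_iff)
  then have q: "0 < q" unfolding q_def by linarith
  have "a ^ m - b ^ m = a ^ m * q" using a by (simp add: q_def power_divide field_simps)
  then have U: "lucas_U P Q m = a ^ m * q / (a - b)"
    by (simp add: lucas_U_def a_def b_def)
  have U0: "0 < lucas_U P Q m" unfolding U using a q ba by simp
  have lnU: "ln (lucas_U P Q m) = of_nat m * ln a + ln q - ln (a - b)"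
    unfolding U using a q ba by (simp add: ln_div ln_mult ln_realpow)
  have real_powr: "complex_of_real u powr w = exp (w * of_real (ln u))" if "0 < u" for u w
    using that by (simp add: powr_def Ln_of_real)
  have "1 - of_real (b / a) ^ m = complex_of_real q" by (simp add: q_def)
  then have "(1 - complex_of_real (b / a) ^ m) powr (- z) = exp (- z * of_real (ln q))"
    using real_powr[OF q] by simp
  moreover have "y ^ m / of_real (lucas_U P Q m) powr z = y ^ m * exp (- z * of_real (ln (lucas_U P Q m)))"
    unfolding real_powr[OF U0] by (simp add: divide_inverse exp_minus)
  moreover have "exp (- z * of_real (ln (lucas_U P Q m))) =
      exp (of_real (ln (a - b)) * z) * (exp (- of_real (ln a) * z) ^ m * exp (- z * of_real (ln q)))"
    unfolding lnU by (simp add: exp_of_nat_mult[symmetric] exp_add[symmetric] algebra_simps)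
  ultimately show ?thesis by (simp add: power_mult_distrib)
qed

section \<open>Meromorphic continuation of the Lucas L-function\<close>

theorem theorem7:
  fixes P Q :: real
    and f :: "'n :: {finite, linorder} \<Rightarrow> int \<Rightarrow> complex"
    and lg :: "'n \<Rightarrow> complex"
  assumes "P > 0" and "Q \<noteq> 0"
    and "P \<le> 2 \<Longrightarrow> Q < P - 1"
    and "P > 2 \<Longrightarrow> Q \<le> P - 1"
    and "\<And>i. additive_character (f i)"
    and "\<And>i. (\<Prod>k\<in>{i..}. cmod (f k 1)) \<le> 1"
    and "\<And>j. exp (lg j) = (\<Prod>k\<in>{j..}. f k 1)"
  shows "(\<forall>s\<in>lucas_L_domain. (\<lambda>n. cmod (lucas_L_term P Q f s n)) summable_on lucas_L_indices) \<and>
    (\<exists>F. mv_meromorphic_on F UNIV \<and>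
         mv_holomorphic_on F (- (\<Union>j k n. lucas_L_hyperplane P Q (lg j) j k n)) \<and>
         (\<forall>s\<in>lucas_L_domain. F s = lucas_L P Q f s))"
proof -
  define a b where "a = lucas_alpha P Q" and "b = lucas_beta P Q"
  define r where "r = b / a"
  have roots: "1 < a" "b < a" "\<bar>b / a\<bar> < 1" "b / a = Q / a\<^sup>2"
    using lucas_roots[of P Q] assms(1-4) by (simp_all add: a_def b_def)
  interpret binomial_continuation r "ln a" "ln (a - b)" lg
  proof
    show "\<bar>r\<bar> < 1" using roots by (simp add: r_def)
    show "r \<noteq> 0" unfolding r_def roots(4) using roots(1) assms(2) by simp
    show "0 < ln a" using roots by simp
  qed
  have on_domain: "(\<lambda>n. cmod (lucas_L_term P Q f s n)) summable_on lucas_L_indices \<and>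
      continuation s = lucas_L P Q f s" if s: "s \<in> lucas_L_domain" for s
  proof -
    \<comment> \<open>The geometric ratios per index, chosen so that their tail products are the y_j
      with k = 0.\<close>
    define x where "x i = f i 1 * exp (- of_real (ln a) * s $ i)" for i
    define t where "t n = (\<Prod>i\<in>UNIV. x i ^ n i * (1 - of_real r ^ n i) powr (- (s $ i)))" for n
    define e where "e = exp (of_real (ln (a - b)) * (\<Sum>i\<in>UNIV. s $ i))"
    have x: "(\<Prod>i\<in>{j..}. x i) = pole_factor (ln a) lg j s" for j
    proof -
      have "(\<Prod>i\<in>{j..}. x i) = exp (lg j) * exp (- of_real (ln a) * (\<Sum>i\<in>{j..}. s $ i))"
        by (simp add: x_def prod.distrib assms(7) sum_distrib_left exp_sum sum_negf[symmetric] del: sum_negf)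
      then show ?thesis by (simp add: pole_factor_def exp_add[symmetric])
    qed
    \<comment> \<open>The bound on the characters gives only <= 1; strictness comes from ln \<alpha>
      > 0 and the positive tail sums of real parts on the domain.\<close>
    have lt: "cmod (pole_factor (ln a) lg j s) < 1" for j
    proof -
      have "cmod (pole_factor (ln a) lg j s) =
          (\<Prod>k\<in>{j..}. cmod (f k 1)) * exp (- (ln a * (\<Sum>i\<in>{j..}. Re (s $ i))))"
        by (simp add: pole_factor_def exp_diff norm_divide assms(7) prod_norm exp_minus divide_inverse
              norm_mult norm_inverse norm_exp_eq_Re)
      also have "\<dots> \<le> 1 * exp (- (ln a * (\<Sum>i\<in>{j..}. Re (s $ i))))"
        by (rule mult_right_mono[OF assms(6)]) simp
      also have "\<dots> < 1"
        using s roots(1) by (simp add: lucas_L_domain_def)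
      finally show ?thesis .
    qed
    have term_eq: "lucas_L_term P Q f s n = e * t n" if n: "n \<in> lucas_L_indices" for n
    proof -
      have "f i (int (n i)) / of_real (lucas_U P Q (n i)) powr (s $ i) =
          exp (of_real (ln (a - b)) * s $ i) * (x i ^ n i * (1 - of_real r ^ n i) powr (- (s $ i)))" for i
        unfolding additive_character_of_nat[OF assms(5)] x_def r_def a_def b_def
        by (rule lucas_factor[OF roots(1-3)[unfolded a_def b_def]])
           (use n in \<open>simp add: lucas_L_indices_def\<close>)
      then show ?thesis
        by (simp add: lucas_L_term_def prod.distrib e_def t_def sum_distrib_left exp_sum)
    qed
    note sums = sum_over_indices[of x s, OF x lt, folded t_def]
    have "(\<lambda>n. cmod (lucas_L_term P Q f s n)) summable_on lucas_L_indices"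
      using summable_on_cmult_right[OF sums(1), of "cmod e"]
      by (simp add: term_eq norm_mult cong: summable_on_cong)
    moreover have "lucas_L P Q f s = e * infsum t lucas_L_indices"
      unfolding lucas_L_def infsum_cmult_right'[symmetric] by (rule infsum_cong) (rule term_eq)
    ultimately show ?thesis
      using sums(2) by (simp add: continuation_def e_def)
  qed
  have "- (\<Union>j k n. lucas_L_hyperplane P Q (lg j) j k n) = {s. \<forall>j K. pole_term j s K \<noteq> 1}"
  proof -
    have hyp: "(\<exists>n. s \<in> lucas_L_hyperplane P Q (lg j) j k n) \<longleftrightarrow> pole_term j s (tail_sum k j) = 1" for s j k
      unfolding pole_term_def using lucas_L_hyperplane_iff[of P Q r s lg j k] roots assms(2)
      by (simp add: a_def b_def r_def)
    \<comment> \<open>Placing all of K at the index \<open>j\<close> realises every natural number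
      as a tail sum, so the hyperplanes over all k match the pole terms over all K.\<close>
    have "\<exists>k. tail_sum k j = K" for j :: 'n and K
      by (rule exI[of _ "\<lambda>i. if i = j then K else 0"]) (simp add: tail_sum_def)
    then have "(\<exists>k. pole_term j s (tail_sum k j) = 1) \<longleftrightarrow> (\<exists>K. pole_term j s K = 1)" for j s
      by metis
    then show ?thesis using hyp by (auto simp: set_eq_iff) metis+
  qed
  then show ?thesis
    using continuation_meromorphic continuation_holomorphic on_domain by auto
qed

end
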